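(* Let $n,k\in\mathbb{Z}_{\ge1}$ and let $G\subseteq S_n$ be a subgroup. The centralizer algebra $\mathrm{End}_G(M_n^{\otimes k})$ has a basis $$\{X_{(r|r')}\mid (r|r')\in[1,n]^{2k}/G\}.$$ In particular, $\dim(\mathrm{End}_G(M_n^{\otimes k}))$ equals the number of $G$-orbits on $[1,n]^{2k}$.
   Context: $\mathbb{F}$ is a field of characteristic zero and $[1,n]=\{1,\dots,n\}$. $M_n$ is the $n$-dimensional permutation module of $S_n$ over $\mathbb{F}$ with basis $v_1,\dots,v_n$, $\sigma.v_i=v_{\sigma(i)}$, and $S_n$ (hence $G$) acts diagonally on $M_n^{\otimes k}$. $\mathrm{End}_G(M_n^{\otimes k})$ is the algebra of $\varphi\in\mathrm{End}(M_n^{\otimes k})$ with $\varphi\sigma=\sigma\varphi$ for all $\sigma\in G$. For $r=(r_1,\dots,r_k)\in[1,n]^k$ put $v_r=v_{r_1}\otimes\cdots\otimes v_{r_k}$; for $r,s\in[1,n]^k$, $E_r^s\in\mathrm{End}(M_n^{\otimes k})$ is the matrix unit with $E_r^s v_t=\delta_{r,t}v_s$. For $r=(r_1,\dots,r_k)$ and $r'=(r_{k+1},\dots,r_{2k})$ in $[1,n]^k$, $(r|r')=(r_1,\dots,r_{2k})\in[1,n]^{2k}$. $G$ acts on $[1,n]^{2k}$ by $\sigma(r_1,\dots,r_{2k})=(\sigma(r_1),\dots,\sigma(r_{2k}))$; $G(r|r')$ is the orbit of $(r|r')$; and $[1,n]^{2k}/G$ denotes a set consisting of one $2k$-tuple from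 each $G$-orbit. Define $$X_{(r|r')}=\sum_{(s|s')\in G(r|r')}E_s^{s'},$$ the sum being over the distinct elements of the orbit. *)

theory Defs
  imports
    Complex_Main
    "HOL-Library.Function_Algebras"
    "HOL-Algebra.Sym_Groups"
    "HOL-Algebra.Group_Action"
begin

section \<open>The permutation module and its tensor powers\<close>

text \<open>
  Vectors are coordinate functions with pointwise addition (from Function_Algebras).
  A vector of \<open>M_n\<close> is a function on the naturals vanishing off \<open>{1..n}\<close>. A vector of the
  \<open>k\<close>-th tensor power of \<open>M_n\<close> is a function on lists vanishing off the set of \<open>k\<close>-tuples
  over \<open>{1..n}\<close>. That this is the tensor power is justified by the lemmas on \<open>pure_tensor\<close>:
  it is multilinear, and it sends the tuples of basis vectors of \<open>M_n\<close> bijectively to a basis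
  (\<open>pure_tensor_add\<close>, \<open>pure_tensor_scale\<close>, \<open>inj_tensor_vec\<close>, \<open>tensor_vec_basis\<close>).
\<close>

definition fun_scale :: "'f::field \<Rightarrow> ('i \<Rightarrow> 'f) \<Rightarrow> 'i \<Rightarrow> 'f" where
  "fun_scale c u = (\<lambda>i. c * u i)"

definition tuples :: "nat \<Rightarrow> nat \<Rightarrow> nat list set" where
  "tuples n m = {r. length r = m \<and> set r \<subseteq> {1..n}}"

definition perm_module :: "nat \<Rightarrow> (nat \<Rightarrow> 'f::field) set" where
  "perm_module n = {u. \<forall>i. i \<notin> {1..n} \<longrightarrow> u i = 0}"

definition basis_vec :: "nat \<Rightarrow> nat \<Rightarrow> 'f::field" where
  "basis_vec i = (\<lambda>j. if j = i then 1 else 0)"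

text \<open>The coordinate form of the linear action with \<open>\<sigma>.v_i = v_{\<sigma>(i)}\<close>.\<close>

definition perm_act :: "(nat \<Rightarrow> nat) \<Rightarrow> (nat \<Rightarrow> 'f::field) \<Rightarrow> nat \<Rightarrow> 'f" where
  "perm_act \<sigma> u = (\<lambda>j. u (Hilbert_Choice.inv \<sigma> j))"

definition tensor_power :: "nat \<Rightarrow> nat \<Rightarrow> (nat list \<Rightarrow> 'f::field) set" where
  "tensor_power n k = {x. \<forall>r. r \<notin> tuples n k \<longrightarrow> x r = 0}"

definition pure_tensor :: "(nat \<Rightarrow> 'f::field) list \<Rightarrow> nat list \<Rightarrow> 'f" where
  "pure_tensor us =
     (\<lambda>r. if length r = length us then \<Prod>i<length us. (us ! i) (r ! i) else 0)"

definition tensor_vec :: "nat list \<Rightarrow> nat list \<Rightarrow> 'f::field" where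
  "tensor_vec r = pure_tensor (map basis_vec r)"

text \<open>
  The diagonal action in coordinates; on pure tensors see \<open>tensor_act_pure_tensor\<close> below.
\<close>

definition tensor_act :: "(nat \<Rightarrow> nat) \<Rightarrow> (nat list \<Rightarrow> 'f::field) \<Rightarrow> nat list \<Rightarrow> 'f" where
  "tensor_act \<sigma> x = (\<lambda>r. x (map (Hilbert_Choice.inv \<sigma>) r))"


section \<open>The centralizer algebra\<close>

type_synonym 'f tensor_map = "(nat list \<Rightarrow> 'f) \<Rightarrow> (nat list \<Rightarrow> 'f)"

text \<open>
  A linear endomorphism of the tensor power is represented by a HOL function that is \<open>0\<close>
  outside the carrier. This makes the representation unique, and makes the endomorphisms a
  subspace of the vector space of all functions with pointwise operations.
\<close>

definition tensor_End ::
  "nat \<Rightarrow> nat \<Rightarrow> 'f::field tensor_map set" where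
  "tensor_End n k = {\<phi>.
     (\<forall>x \<in> tensor_power n k. \<phi> x \<in> tensor_power n k) \<and>
     (\<forall>x \<in> tensor_power n k. \<forall>y \<in> tensor_power n k. \<phi> (x + y) = \<phi> x + \<phi> y) \<and>
     (\<forall>c. \<forall>x \<in> tensor_power n k. \<phi> (fun_scale c x) = fun_scale c (\<phi> x)) \<and>
     (\<forall>x. x \<notin> tensor_power n k \<longrightarrow> \<phi> x = 0)}"

definition centralizer_algebra ::
  "nat \<Rightarrow> nat \<Rightarrow> (nat \<Rightarrow> nat) set \<Rightarrow> 'f::field tensor_map set" where
  "centralizer_algebra n k G = {\<phi> \<in> tensor_End n k.
     \<forall>\<sigma> \<in> G. \<forall>x \<in> tensor_power n k. \<phi> (tensor_act \<sigma> x) = tensor_act \<sigma> (\<phi> x)}"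

definition end_scale ::
  "'f::field \<Rightarrow> 'f tensor_map \<Rightarrow> 'f tensor_map" where
  "end_scale c \<phi> = (\<lambda>x. fun_scale c (\<phi> x))"

global_interpretation vec: vector_space "fun_scale :: 'f::field \<Rightarrow> ('i \<Rightarrow> 'f) \<Rightarrow> 'i \<Rightarrow> 'f"
  by unfold_locales (auto simp: fun_scale_def fun_eq_iff algebra_simps)

global_interpretation endo: vector_space
  "end_scale :: 'f::field \<Rightarrow> 'f tensor_map \<Rightarrow> 'f tensor_map"
  by unfold_locales (auto simp: end_scale_def fun_scale_def fun_eq_iff algebra_simps)

definition is_basis_family :: "('i \<Rightarrow> 'f::field tensor_map) \<Rightarrow> 'i set \<Rightarrow> 'f tensor_map set \<Rightarrow> bool" where
  "is_basis_family b I V \<longleftrightarrow> inj_on b I \<and> endo.independent (b ` I) \<and> endo.span (b ` I) = V"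

text \<open>\<open>E_r^s\<close>, the endomorphism with \<open>E_r^s v_t = \<delta>_{r,t} v_s\<close>.\<close>

definition matrix_unit ::
  "nat \<Rightarrow> nat \<Rightarrow> nat list \<Rightarrow> nat list \<Rightarrow> 'f::field tensor_map" where
  "matrix_unit n k r s =
     (\<lambda>x. if x \<in> tensor_power n k then fun_scale (x r) (tensor_vec s) else 0)"


section \<open>Orbits of tuples\<close>

text \<open>
  \<open>(r|r')\<close> is the concatenation \<open>r @ r'\<close>; so \<open>2k\<close>-tuples are elements of \<open>tuples n (2 * k)\<close>,
  split by \<open>take k\<close> and \<open>drop k\<close>. The restriction to \<open>tuples n m\<close> makes this a group action
  in the sense of HOL-Algebra.
\<close>

definition tuple_act :: "nat \<Rightarrow> nat \<Rightarrow> (nat \<Rightarrow> nat) \<Rightarrow> nat list \<Rightarrow> nat list" where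
  "tuple_act n m = (\<lambda>\<sigma>. \<lambda>r \<in> tuples n m. map \<sigma> r)"

abbreviation perm_subgroup :: "nat \<Rightarrow> (nat \<Rightarrow> nat) set \<Rightarrow> (nat \<Rightarrow> nat) monoid" where
  "perm_subgroup n G \<equiv> (sym_group n)\<lparr>carrier := G\<rparr>"

definition tuple_orbit :: "nat \<Rightarrow> nat \<Rightarrow> (nat \<Rightarrow> nat) set \<Rightarrow> nat list \<Rightarrow> nat list set" where
  "tuple_orbit n m G = orbit (perm_subgroup n G) (tuple_act n m)"

definition tuple_orbits :: "nat \<Rightarrow> nat \<Rightarrow> (nat \<Rightarrow> nat) set \<Rightarrow> nat list set set" where
  "tuple_orbits n m G = orbits (perm_subgroup n G) (tuples n m) (tuple_act n m)"

definition orbit_representatives ::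
  "nat \<Rightarrow> nat \<Rightarrow> (nat \<Rightarrow> nat) set \<Rightarrow> nat list set \<Rightarrow> bool" where
  "orbit_representatives n m G T \<longleftrightarrow>
     T \<subseteq> tuples n m \<and> (\<forall>Q \<in> tuple_orbits n m G. \<exists>!t. t \<in> T \<and> t \<in> Q)"

definition orbit_endo ::
  "nat \<Rightarrow> nat \<Rightarrow> (nat \<Rightarrow> nat) set \<Rightarrow> nat list \<Rightarrow> 'f::field tensor_map" where
  "orbit_endo n k G t =
     (\<Sum>s \<in> tuple_orbit n (2 * k) G t. matrix_unit n k (take k s) (drop k s))"


section \<open>Adequacy of the encoding\<close>

lemma finite_tuples: "finite (tuples n m)"
proof -
  have "tuples n m = {r. set r \<subseteq> {1..n} \<and> length r = m}"
    by (auto simp: tuples_def)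
  then show ?thesis
    by (simp add: finite_lists_length_eq)
qed

lemma perm_act_basis_vec:
  assumes "\<sigma> permutes {1..n}"
  shows "perm_act \<sigma> (basis_vec i) = basis_vec (\<sigma> i)"
  using assms by (auto simp: perm_act_def basis_vec_def fun_eq_iff permutes_inverses)

lemma pure_tensor_in_tensor_power:
  assumes "length us = k" "set us \<subseteq> perm_module n"
  shows "pure_tensor us \<in> tensor_power n k"
  unfolding tensor_power_def
proof (intro CollectI allI impI)
  fix r assume r: "r \<notin> tuples n k"
  show "pure_tensor us r = 0"
  proof (cases "length r = k")
    case True
    with r obtain i where i: "i < k" "r ! i \<notin> {1..n}"
      by (auto simp: tuples_def in_set_conv_nth subset_iff)
    with assms have "us ! i \<in> perm_module n" by auto
    with i have "(us ! i) (r ! i) = 0" by (auto simp: perm_module_def)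
    with i show ?thesis using assms by (auto simp: pure_tensor_def)
  qed (use assms in \<open>simp add: pure_tensor_def\<close>)
qed

lemma pure_tensor_split:
  assumes "i < length us"
  shows "pure_tensor (us[i := w]) r =
    (if length r = length us
     then w (r ! i) * (\<Prod>j \<in> {..<length us} - {i}. (us ! j) (r ! j)) else 0)"
proof -
  have "(\<Prod>j<length us. (us[i := w] ! j) (r ! j)) =
      (us[i := w] ! i) (r ! i) * (\<Prod>j \<in> {..<length us} - {i}. (us[i := w] ! j) (r ! j))"
    using assms by (subst prod.remove[of _ i]) auto
  also have "\<dots> = w (r ! i) * (\<Prod>j \<in> {..<length us} - {i}. (us ! j) (r ! j))"
    using assms by (auto intro!: prod.cong)
  finally show ?thesis by (simp add: pure_tensor_def)
qed

lemma pure_tensor_add: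
  assumes "i < length us"
  shows "pure_tensor (us[i := v + w]) = pure_tensor (us[i := v]) + pure_tensor (us[i := w])"
  using assms by (auto simp: fun_eq_iff pure_tensor_split algebra_simps)

lemma pure_tensor_scale:
  assumes "i < length us"
  shows "pure_tensor (us[i := fun_scale c w]) = fun_scale c (pure_tensor (us[i := w]))"
  using assms by (auto simp: fun_eq_iff pure_tensor_split fun_scale_def)

lemma tensor_vec_apply: "tensor_vec r t = (if t = r then 1 else 0)"
proof (cases "length t = length r")
  case True
  have "(\<Prod>i<length r. basis_vec (r ! i) (t ! i)) = (if t = r then 1 else 0 :: 'a)"
    using True by (auto simp: basis_vec_def list_eq_iff_nth_eq)
  with True show ?thesis by (simp add: tensor_vec_def pure_tensor_def)
qed (auto simp: tensor_vec_def pure_tensor_def)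

lemma tensor_vec_in: "r \<in> tuples n k \<Longrightarrow> tensor_vec r \<in> tensor_power n k"
  by (auto simp: tensor_power_def tensor_vec_apply)

lemma tensor_power_expand:
  assumes "x \<in> tensor_power n k"
  shows "x = (\<Sum>r \<in> tuples n k. fun_scale (x r) (tensor_vec r))"
proof
  fix t
  have app: "(\<Sum>r \<in> A. f r) t = (\<Sum>r \<in> A. f r t)"
    for A and f :: "nat list \<Rightarrow> nat list \<Rightarrow> 'a"
    by (induction A rule: infinite_finite_induct) auto
  have "(\<Sum>r \<in> tuples n k. fun_scale (x r) (tensor_vec r) t) =
      (\<Sum>r \<in> tuples n k. if t = r then x r else 0)"
    by (intro sum.cong) (auto simp: fun_scale_def tensor_vec_apply)
  also have "\<dots> = x t"
    using assms by (auto simp: finite_tuples tensor_power_def)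
  finally show "x t = (\<Sum>r \<in> tuples n k. fun_scale (x r) (tensor_vec r)) t"
    by (simp add: app)
qed

lemma inj_tensor_vec: "inj (tensor_vec :: nat list \<Rightarrow> nat list \<Rightarrow> 'f::field)"
proof (rule injI)
  fix r s :: "nat list"
  assume "tensor_vec r = (tensor_vec s :: nat list \<Rightarrow> 'f)"
  then have "tensor_vec r r = (tensor_vec s r :: 'f)" by simp
  then show "r = s" by (simp add: tensor_vec_apply split: if_splits)
qed

lemma subspace_tensor_power: "vec.subspace (tensor_power n k)"
  by (auto simp: vec.subspace_def tensor_power_def fun_scale_def)

lemma tensor_vec_basis:
  fixes n k :: nat and B :: "(nat list \<Rightarrow> 'f::field) set"
  defines "B \<equiv> tensor_vec ` tuples n k"
  shows "vec.independent B" "vec.span B = tensor_power n k"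
proof -
  show "vec.span B = tensor_power n k"
  proof
    show "vec.span B \<subseteq> tensor_power n k"
      by (intro vec.span_minimal subspace_tensor_power) (auto simp: B_def tensor_vec_in)
    show "tensor_power n k \<subseteq> vec.span B"
    proof
      fix x :: "nat list \<Rightarrow> 'f" assume "x \<in> tensor_power n k"
      then have "x = (\<Sum>r \<in> tuples n k. fun_scale (x r) (tensor_vec r))"
        by (rule tensor_power_expand)
      moreover have "\<dots> \<in> vec.span B"
        by (intro vec.span_sum vec.span_scale vec.span_base) (auto simp: B_def)
      ultimately show "x \<in> vec.span B" by simp
    qed
  qed
  show "vec.independent B"
  proof
    assume "vec.dependent B"
    then obtain b where b: "b \<in> B" "b \<in> vec.span (B - {b})"
      by (auto simp: vec.dependent_def)
    from b(1) obtain r where r: "b = tensor_vec r" by (auto simp: B_def)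
    have "vec.subspace {x :: nat list \<Rightarrow> 'f. x r = 0}"
      by (auto simp: vec.subspace_def fun_scale_def)
    moreover have "B - {b} \<subseteq> {x. x r = 0}"
      by (auto simp: B_def r tensor_vec_apply)
    ultimately have "vec.span (B - {b}) \<subseteq> {x. x r = 0}"
      by (intro vec.span_minimal)
    with b(2) r show False by (auto simp: tensor_vec_apply)
  qed
qed

lemma map_inv_in_tuples_iff:
  assumes "\<sigma> permutes {1..n}"
  shows "map (Hilbert_Choice.inv \<sigma>) r \<in> tuples n k \<longleftrightarrow> r \<in> tuples n k"
proof -
  have "Hilbert_Choice.inv \<sigma> i \<in> {1..n} \<longleftrightarrow> i \<in> {1..n}" for i
    using permutes_in_image[OF permutes_inv[OF assms]] .
  then show ?thesis unfolding tuples_def by (auto simp del: atLeastAtMost_iff)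
qed

lemma tensor_act_in:
  assumes "\<sigma> permutes {1..n}" "x \<in> tensor_power n k"
  shows "tensor_act \<sigma> x \<in> tensor_power n k"
  using assms by (auto simp: tensor_power_def tensor_act_def map_inv_in_tuples_iff)

lemma tensor_act_linear:
  "tensor_act \<sigma> (x + y) = tensor_act \<sigma> x + tensor_act \<sigma> y"
  "tensor_act \<sigma> (fun_scale c x) = fun_scale c (tensor_act \<sigma> x)"
  by (auto simp: tensor_act_def fun_scale_def fun_eq_iff)

lemma tensor_act_pure_tensor:
  "tensor_act \<sigma> (pure_tensor us) = pure_tensor (map (perm_act \<sigma>) us)"
  by (auto simp: tensor_act_def pure_tensor_def perm_act_def fun_eq_iff)

lemma tensor_act_tensor_vec:
  assumes "\<sigma> permutes {1..n}"
  shows "tensor_act \<sigma> (tensor_vec r) = tensor_vec (map \<sigma> r)"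
  using assms
  by (simp add: tensor_vec_def tensor_act_pure_tensor perm_act_basis_vec o_def)

lemma matrix_unit_tensor_vec:
  assumes "t \<in> tuples n k"
  shows "matrix_unit n k r s (tensor_vec t) = (if r = t then tensor_vec s else 0)"
  using tensor_vec_in[OF assms]
  by (auto simp: matrix_unit_def tensor_vec_apply fun_scale_def fun_eq_iff)

lemma tensor_power_closed:
  assumes "x \<in> tensor_power n k"
  shows "y \<in> tensor_power n k \<Longrightarrow> x + y \<in> tensor_power n k"
    and "fun_scale c x \<in> tensor_power n k"
  using assms by (auto simp: tensor_power_def fun_scale_def)

lemma matrix_unit_in_tensor_End:
  assumes "s \<in> tuples n k"
  shows "matrix_unit n k r s \<in> tensor_End n k"
  unfolding tensor_End_def
proof (intro CollectI conjI allI ballI impI)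
  fix x y :: "nat list \<Rightarrow> 'a" and c assume x: "x \<in> tensor_power n k"
  show "matrix_unit n k r s x \<in> tensor_power n k"
    using x by (simp add: matrix_unit_def tensor_power_closed tensor_vec_in assms)
  show "matrix_unit n k r s (fun_scale c x) = fun_scale c (matrix_unit n k r s x)"
    using x tensor_power_closed(2)[OF x, of c]
    by (simp add: matrix_unit_def vec.scale_scale) (simp add: fun_scale_def)
  assume y: "y \<in> tensor_power n k"
  show "matrix_unit n k r s (x + y) = matrix_unit n k r s x + matrix_unit n k r s y"
    using x y tensor_power_closed(1)[OF x y]
    by (simp add: matrix_unit_def vec.scale_left_distrib)
qed (simp add: matrix_unit_def)

lemma subspace_centralizer_algebra: "endo.subspace (centralizer_algebra n k G)"
proof (rule endo.subspaceI)
  show "0 \<in> centralizer_algebra n k G"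
    by (simp add: centralizer_algebra_def tensor_End_def fun_scale_def tensor_act_def
        tensor_power_def fun_eq_iff)
next
  fix \<phi> \<psi> :: "'a tensor_map"
  assume *: "\<phi> \<in> centralizer_algebra n k G" "\<psi> \<in> centralizer_algebra n k G"
  then show "\<phi> + \<psi> \<in> centralizer_algebra n k G"
    unfolding centralizer_algebra_def tensor_End_def
    by (simp add: tensor_power_closed tensor_act_linear vec.scale_right_distrib add_ac)
next
  fix c and \<phi> :: "'a tensor_map"
  assume "\<phi> \<in> centralizer_algebra n k G"
  then show "end_scale c \<phi> \<in> centralizer_algebra n k G"
    unfolding centralizer_algebra_def tensor_End_def
    by (simp add: end_scale_def tensor_power_closed tensor_act_linear
        vec.scale_right_distrib vec.scale_scale mult.commute)
qed

lemma tuple_orbit_eq: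
  assumes "t \<in> tuples n m"
  shows "tuple_orbit n m G t = {map \<sigma> t | \<sigma>. \<sigma> \<in> G}"
  using assms by (auto simp: tuple_orbit_def orbit_def tuple_act_def)

lemma tuple_orbits_eq: "tuple_orbits n m G = tuple_orbit n m G ` tuples n m"
  by (auto simp: tuple_orbits_def tuple_orbit_def orbits_def)

lemma tuple_group_action:
  assumes "subgroup G (sym_group n)"
  shows "group_action (perm_subgroup n G) (tuples n m) (tuple_act n m)"
proof -
  have perm: "\<sigma> permutes {1..n}" if "\<sigma> \<in> G" for \<sigma>
    using subgroup.subset[OF assms] that by (auto simp: sym_group_def)
  have closed: "map \<sigma> r \<in> tuples n m" if "\<sigma> permutes {1..n}" "r \<in> tuples n m" for \<sigma> r
    using that permutes_in_image[OF that(1)]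
    unfolding tuples_def by (auto simp del: atLeastAtMost_iff)
  have bij: "tuple_act n m \<sigma> \<in> Bij (tuples n m)" if "\<sigma> permutes {1..n}" for \<sigma>
  proof -
    have inv: "Hilbert_Choice.inv \<sigma> (\<sigma> i) = i" "\<sigma> (Hilbert_Choice.inv \<sigma> i) = i" for i
      using that by (simp_all add: permutes_inverses)
    have "bij_betw (map \<sigma>) (tuples n m) (tuples n m)"
    proof (rule bij_betw_byWitness[where f' = "map (Hilbert_Choice.inv \<sigma>)"])
      show "map \<sigma> ` tuples n m \<subseteq> tuples n m"
        using closed[OF that] by blast
      show "map (Hilbert_Choice.inv \<sigma>) ` tuples n m \<subseteq> tuples n m"
        using closed[OF permutes_inv[OF that]] by blast
    qed (simp_all add: inv o_def)
    then have "bij_betw (tuple_act n m \<sigma>) (tuples n m) (tuples n m)"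
      by (simp add: tuple_act_def cong: bij_betw_cong)
    then show ?thesis by (auto simp: Bij_def tuple_act_def)
  qed
  have "tuple_act n m \<in> hom (perm_subgroup n G) (BijGroup (tuples n m))"
  proof (rule homI)
    fix \<sigma> assume "\<sigma> \<in> carrier (perm_subgroup n G)"
    then show "tuple_act n m \<sigma> \<in> carrier (BijGroup (tuples n m))"
      by (auto simp: BijGroup_def intro!: bij perm)
  next
    fix \<sigma> \<tau>
    assume "\<sigma> \<in> carrier (perm_subgroup n G)" "\<tau> \<in> carrier (perm_subgroup n G)"
    then have "\<sigma> \<in> G" "\<tau> \<in> G" by simp_all
    then have st: "\<sigma> permutes {1..n}" "\<tau> permutes {1..n}" by (blast intro: perm)+
    have "tuple_act n m (\<sigma> \<circ> \<tau>) = compose (tuples n m) (tuple_act n m \<sigma>) (tuple_act n m \<tau>)"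
      using closed[OF st(2)] by (auto simp: tuple_act_def compose_def fun_eq_iff)
    then show "tuple_act n m (\<sigma> \<otimes>\<^bsub>perm_subgroup n G\<^esub> \<tau>) =
        tuple_act n m \<sigma> \<otimes>\<^bsub>BijGroup (tuples n m)\<^esub> tuple_act n m \<tau>"
      using bij[OF st(1)] bij[OF st(2)] by (simp add: BijGroup_def sym_group_def)
  qed
  moreover have "Group.group (perm_subgroup n G)"
    using subgroup.subgroup_is_group[OF assms sym_group_is_group] .
  ultimately show ?thesis
    unfolding group_action_def group_hom_def group_hom_axioms_def
    by (simp add: group_BijGroup)
qed

lemma orbit_representatives_exist:
  assumes "subgroup G (sym_group n)"
  shows "\<exists>T. orbit_representatives n m G T"
proof -
  interpret A: group_action "perm_subgroup n G" "tuples n m" "tuple_act n m"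
    by (rule tuple_group_action[OF assms])
  let ?Os = "tuple_orbits n m G"
  define T where "T = (\<lambda>Q. SOME t. t \<in> Q) ` ?Os"
  have rep: "(SOME t. t \<in> Q) \<in> Q" if "Q \<in> ?Os" for Q
  proof -
    from that obtain t where "Q = orbit (perm_subgroup n G) (tuple_act n m) t" "t \<in> tuples n m"
      unfolding tuple_orbits_def orbits_def by blast
    then have "t \<in> Q" using A.orbit_refl by blast
    then show ?thesis by (rule someI)
  qed
  have disj: "Q = Q'" if "Q \<in> ?Os" "Q' \<in> ?Os" "t \<in> Q" "t \<in> Q'" for Q Q' t
    using A.disjoint_union[of Q Q'] that unfolding tuple_orbits_def by blast
  have sub: "Q \<subseteq> tuples n m" if "Q \<in> ?Os" for Q
    using A.orbits_coverture that unfolding tuple_orbits_def by blast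
  have "orbit_representatives n m G T"
    unfolding orbit_representatives_def
  proof (intro conjI ballI ex1I)
    show "T \<subseteq> tuples n m" using rep sub unfolding T_def by blast
  next
    fix Q assume Q: "Q \<in> ?Os"
    show "(SOME t. t \<in> Q) \<in> T" using Q by (simp add: T_def)
    show "(SOME t. t \<in> Q) \<in> Q" using rep[OF Q] .
    fix t assume "t \<in> T \<and> t \<in> Q"
    then obtain Q' where Q': "Q' \<in> ?Os" "t = (SOME t. t \<in> Q')" "t \<in> Q" unfolding T_def by blast
    then have "t \<in> Q'" using rep[OF Q'(1)] by simp
    from disj[OF Q Q'(1) Q'(3) this] have "Q = Q'" .
    with Q'(2) show "t = (SOME t. t \<in> Q)" by metis
  qed
  then show ?thesis by blast
qed

end

theory Submission
  imports Defs
begin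

text \<open>
  An endomorphism of the tensor power is determined by its matrix with respect to the basis
  \<open>tensor_vec\<close>, a function on \<open>2k\<close>-tuples whose first half indexes the column and whose
  second half indexes the row. Since a permutation only relabels basis vectors, commuting with
  \<open>G\<close> means exactly that this function is constant on \<open>G\<close>-orbits
  (\<open>centralizer_iff_coeff_invariant\<close>). The matrix of \<open>orbit_endo\<close> is the indicator function
  of an orbit (\<open>matrix_coeff_orbit_endo\<close>), and the indicator functions of the orbits form a
  basis of the functions that are constant on orbits: the coordinates are the values at a set of
  representatives, which gives both spanning and independence.
\<close>

section \<open>Matrix coefficients of endomorphisms\<close>

definition matrix_coeff :: "nat \<Rightarrow> 'f::field tensor_map \<Rightarrow> nat list \<Rightarrow> 'f" where
  "matrix_coeff k \<phi> q = \<phi> (tensor_vec (take k q)) (drop k q)"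

lemma sum_apply: "(\<Sum>a \<in> A. f a) x = (\<Sum>a \<in> A. f a x)"
  by (induction A rule: infinite_finite_induct) auto

lemma matrix_coeff_0: "matrix_coeff k 0 q = 0"
  and matrix_coeff_add: "matrix_coeff k (\<phi> + \<psi>) q = matrix_coeff k \<phi> q + matrix_coeff k \<psi> q"
  and matrix_coeff_scale: "matrix_coeff k (end_scale c \<phi>) q = c * matrix_coeff k \<phi> q"
  and matrix_coeff_sum: "matrix_coeff k (\<Sum>a \<in> A. f a) q = (\<Sum>a \<in> A. matrix_coeff k (f a) q)"
  by (simp_all add: matrix_coeff_def end_scale_def fun_scale_def sum_apply)

lemma tuples_halves:
  assumes "q \<in> tuples n (2 * k)"
  shows "take k q \<in> tuples n k" "drop k q \<in> tuples n k"
  using assms set_take_subset[of k q] set_drop_subset[of k q] by (auto simp: tuples_def)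

lemma append_in_tuples: "r \<in> tuples n k \<Longrightarrow> s \<in> tuples n k \<Longrightarrow> r @ s \<in> tuples n (2 * k)"
  by (auto simp: tuples_def)

lemma matrix_coeff_append:
  "r \<in> tuples n k \<Longrightarrow> matrix_coeff k \<phi> (r @ s) = \<phi> (tensor_vec r) s"
  by (auto simp: matrix_coeff_def tuples_def)

lemma linear_maps_agree_on_tensor_power:
  fixes f g :: "'f::field tensor_map"
  assumes add: "\<And>x y. x \<in> tensor_power n k \<Longrightarrow> y \<in> tensor_power n k \<Longrightarrow> f (x + y) = f x + f y"
      "\<And>x y. x \<in> tensor_power n k \<Longrightarrow> y \<in> tensor_power n k \<Longrightarrow> g (x + y) = g x + g y"
    and scale: "\<And>c x. x \<in> tensor_power n k \<Longrightarrow> f (fun_scale c x) = fun_scale c (f x)"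
      "\<And>c x. x \<in> tensor_power n k \<Longrightarrow> g (fun_scale c x) = fun_scale c (g x)"
    and basis: "\<And>r. r \<in> tuples n k \<Longrightarrow> f (tensor_vec r) = g (tensor_vec r)"
    and x: "x \<in> tensor_power n k"
  shows "f x = g x"
proof -
  define S where "S = {y \<in> tensor_power n k. f y = g y}"
  have zero: "0 \<in> tensor_power n k" by (simp add: tensor_power_def)
  have "0 \<in> S"
    using scale(1)[OF zero, of 0] scale(2)[OF zero, of 0] zero by (simp add: S_def)
  then have sub: "vec.subspace S"
    by (intro vec.subspaceI) (auto simp: S_def add scale tensor_power_closed)
  have "tensor_vec ` tuples n k \<subseteq> S"
    using basis by (auto simp: S_def tensor_vec_in)
  then have "tensor_power n k \<subseteq> S"
    using vec.span_minimal[OF _ sub] tensor_vec_basis(2) by metis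
  with x show ?thesis by (auto simp: S_def)
qed

lemma tensor_End_apply_outside:
  assumes "\<phi> \<in> tensor_End n k" "x \<in> tensor_power n k" "s \<notin> tuples n k"
  shows "\<phi> x s = 0"
proof -
  have "\<phi> x \<in> tensor_power n k" using assms by (simp add: tensor_End_def)
  with assms(3) show ?thesis by (simp add: tensor_power_def)
qed

lemma tensor_End_eqI:
  assumes \<phi>: "\<phi> \<in> tensor_End n k" and \<psi>: "\<psi> \<in> tensor_End n k"
    and coeff: "\<And>q. q \<in> tuples n (2 * k) \<Longrightarrow> matrix_coeff k \<phi> q = matrix_coeff k \<psi> q"
  shows "\<phi> = \<psi>"
proof
  fix x
  have basis: "\<phi> (tensor_vec r) = \<psi> (tensor_vec r)" if r: "r \<in> tuples n k" for r
  proof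
    fix s
    show "\<phi> (tensor_vec r) s = \<psi> (tensor_vec r) s"
    proof (cases "s \<in> tuples n k")
      case True
      then show ?thesis
        using coeff[OF append_in_tuples[OF r True]] r by (simp add: matrix_coeff_append)
    next
      case False
      then show ?thesis
        by (simp add: tensor_End_apply_outside[OF \<phi> tensor_vec_in[OF r]]
            tensor_End_apply_outside[OF \<psi> tensor_vec_in[OF r]])
    qed
  qed
  show "\<phi> x = \<psi> x"
  proof (cases "x \<in> tensor_power n k")
    case True
    show ?thesis
      by (rule linear_maps_agree_on_tensor_power[where f = \<phi> and g = \<psi>, OF _ _ _ _ basis True])
        (use \<phi> \<psi> in \<open>simp_all add: tensor_End_def\<close>)
  qed (use \<phi> \<psi> in \<open>simp add: tensor_End_def\<close>)
qed

lemma matrix_coeff_matrix_unit: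
  assumes "q \<in> tuples n (2 * k)" "p \<in> tuples n (2 * k)"
  shows "matrix_coeff k (matrix_unit n k (take k p) (drop k p)) q = (if p = q then 1 else 0)"
proof -
  have "p = q \<longleftrightarrow> take k p = take k q \<and> drop k p = drop k q"
    by (metis append_take_drop_id)
  then show ?thesis
    using tuples_halves[OF assms(1)]
    by (auto simp: matrix_coeff_def matrix_unit_tensor_vec tensor_vec_apply)
qed

section \<open>Commuting with the group action\<close>

lemma subgroup_sym_group_permutes:
  "subgroup G (sym_group n) \<Longrightarrow> \<sigma> \<in> G \<Longrightarrow> \<sigma> permutes {1..n}"
  using subgroup.subset by (fastforce simp: sym_group_def)

lemma map_permutes_in_tuples:
  assumes "\<sigma> permutes {1..n}" "r \<in> tuples n m"
  shows "map \<sigma> r \<in> tuples n m"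
  using assms permutes_in_image[OF assms(1)]
  unfolding tuples_def by (auto simp del: atLeastAtMost_iff)

text \<open>
  Since \<open>\<sigma>\<close> maps \<open>v_r\<close> to \<open>v_{\<sigma> r}\<close>, the \<open>\<sigma> s\<close>-coordinate of \<open>\<phi> (\<sigma> v_r)\<close> is the coefficient
  at \<open>(\<sigma> r|\<sigma> s)\<close>, whereas that of \<open>\<sigma> (\<phi> v_r)\<close> is the coefficient at \<open>(r|s)\<close>.
\<close>

lemma centralizer_iff_coeff_invariant:
  fixes \<phi> :: "'f::field tensor_map"
  assumes G: "\<And>\<sigma>. \<sigma> \<in> G \<Longrightarrow> \<sigma> permutes {1..n}"
  shows "\<phi> \<in> centralizer_algebra n k G \<longleftrightarrow> \<phi> \<in> tensor_End n k \<and>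
    (\<forall>\<sigma> \<in> G. \<forall>q \<in> tuples n (2 * k). matrix_coeff k \<phi> (map \<sigma> q) = matrix_coeff k \<phi> q)"
    (is "_ \<longleftrightarrow> _ \<and> ?inv")
proof (intro iffI conjI ballI)
  assume \<phi>: "\<phi> \<in> centralizer_algebra n k G"
  then show "\<phi> \<in> tensor_End n k" by (simp add: centralizer_algebra_def)
  fix \<sigma> q assume \<sigma>: "\<sigma> \<in> G" and q: "q \<in> tuples n (2 * k)"
  have "(tensor_vec (take k q) :: _ \<Rightarrow> 'f) \<in> tensor_power n k"
    by (rule tensor_vec_in[OF tuples_halves(1)[OF q]])
  then have "\<phi> (tensor_vec (map \<sigma> (take k q))) = tensor_act \<sigma> (\<phi> (tensor_vec (take k q)))"
    using \<phi> \<sigma> G[OF \<sigma>] by (simp add: centralizer_algebra_def flip: tensor_act_tensor_vec)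
  then show "matrix_coeff k \<phi> (map \<sigma> q) = matrix_coeff k \<phi> q"
    by (simp add: matrix_coeff_def take_map drop_map tensor_act_def o_def
        permutes_inverses[OF G[OF \<sigma>]])
next
  assume *: "\<phi> \<in> tensor_End n k \<and> ?inv"
  then have \<phi>: "\<phi> \<in> tensor_End n k" and inv: ?inv by auto
  have "\<phi> (tensor_act \<sigma> x) = tensor_act \<sigma> (\<phi> x)"
    if \<sigma>: "\<sigma> \<in> G" and x: "x \<in> tensor_power n k" for \<sigma> x
  proof (rule linear_maps_agree_on_tensor_power[where f = "\<lambda>x. \<phi> (tensor_act \<sigma> x)"
        and g = "\<lambda>x. tensor_act \<sigma> (\<phi> x)", OF _ _ _ _ _ x])
    fix r assume r: "r \<in> tuples n k"
    note \<sigma>r = map_permutes_in_tuples[OF G[OF \<sigma>] r]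
    show "\<phi> (tensor_act \<sigma> (tensor_vec r)) = tensor_act \<sigma> (\<phi> (tensor_vec r))"
    proof
      fix s
      let ?s' = "map (Hilbert_Choice.inv \<sigma>) s"
      have iff: "?s' \<in> tuples n k \<longleftrightarrow> s \<in> tuples n k"
        by (rule map_inv_in_tuples_iff[OF G[OF \<sigma>]])
      have "\<phi> (tensor_vec (map \<sigma> r)) s = \<phi> (tensor_vec r) ?s'"
      proof (cases "s \<in> tuples n k")
        case True
        have "map \<sigma> (r @ ?s') = map \<sigma> r @ s"
          by (simp add: o_def permutes_inverses[OF G[OF \<sigma>]])
        then have "matrix_coeff k \<phi> (map \<sigma> r @ s) = matrix_coeff k \<phi> (r @ ?s')"
          using inv \<sigma> append_in_tuples[OF r iff[THEN iffD2, OF True]] by metis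
        then show ?thesis
          by (simp only: matrix_coeff_append[OF r] matrix_coeff_append[OF \<sigma>r])
      next
        case False
        then show ?thesis
          using iff by (simp add: tensor_End_apply_outside[OF \<phi> tensor_vec_in[OF r]]
              tensor_End_apply_outside[OF \<phi> tensor_vec_in[OF \<sigma>r]])
      qed
      then show "\<phi> (tensor_act \<sigma> (tensor_vec r)) s = tensor_act \<sigma> (\<phi> (tensor_vec r)) s"
        by (simp add: tensor_act_tensor_vec[OF G[OF \<sigma>]]) (simp add: tensor_act_def)
    qed
  qed (use \<phi> in \<open>simp_all add: tensor_End_def tensor_act_linear tensor_act_in[OF G[OF \<sigma>]]\<close>)
  with \<phi> show "\<phi> \<in> centralizer_algebra n k G" by (simp add: centralizer_algebra_def)
qed

section \<open>Orbits and their indicator matrices\<close>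

lemma tuple_orbit_subset:
  assumes "subgroup G (sym_group n)" "t \<in> tuples n m"
  shows "tuple_orbit n m G t \<subseteq> tuples n m"
  using assms
  by (auto simp: tuple_orbit_eq intro!: map_permutes_in_tuples subgroup_sym_group_permutes)

lemma in_tuple_orbit_iff:
  assumes G: "subgroup G (sym_group n)" and s: "s \<in> tuples n m" and t: "t \<in> tuples n m"
  shows "s \<in> tuple_orbit n m G t \<longleftrightarrow> tuple_orbit n m G s = tuple_orbit n m G t"
proof -
  interpret A: group_action "perm_subgroup n G" "tuples n m" "tuple_act n m"
    by (rule tuple_group_action[OF G])
  have refl: "s \<in> tuple_orbit n m G s"
    unfolding tuple_orbit_def by (rule A.orbit_refl[OF s])
  have "tuple_orbit n m G s = tuple_orbit n m G t \<or>
      tuple_orbit n m G s \<inter> tuple_orbit n m G t = {}"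
    using A.disjoint_union[of "tuple_orbit n m G s" "tuple_orbit n m G t"] s t
    unfolding tuple_orbit_def orbits_def by blast
  with refl show ?thesis by blast
qed

lemma tuple_orbit_map:
  assumes G: "subgroup G (sym_group n)" and "\<sigma> \<in> G" and q: "q \<in> tuples n m"
  shows "tuple_orbit n m G (map \<sigma> q) = tuple_orbit n m G q"
proof -
  have "map \<sigma> q \<in> tuple_orbit n m G q" using assms by (auto simp: tuple_orbit_eq)
  then show ?thesis
    using in_tuple_orbit_iff[OF G _ q] tuple_orbit_subset[OF G q] by blast
qed

lemma matrix_coeff_orbit_endo:
  assumes G: "subgroup G (sym_group n)"
    and t: "t \<in> tuples n (2 * k)" and q: "q \<in> tuples n (2 * k)"
  shows "matrix_coeff k (orbit_endo n k G t) q =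
    (if tuple_orbit n (2 * k) G q = tuple_orbit n (2 * k) G t then 1 else 0)"
proof -
  let ?O = "tuple_orbit n (2 * k) G t"
  have sub: "?O \<subseteq> tuples n (2 * k)" by (rule tuple_orbit_subset[OF G t])
  have "matrix_coeff k (orbit_endo n k G t) q = (\<Sum>p \<in> ?O. if p = q then 1 else 0)"
    unfolding orbit_endo_def matrix_coeff_sum
    using sub by (intro sum.cong refl matrix_coeff_matrix_unit[OF q]) auto
  also have "\<dots> = (if q \<in> ?O then 1 else 0)"
    using finite_subset[OF sub finite_tuples] by simp
  finally show ?thesis using in_tuple_orbit_iff[OF G q t] by simp
qed

lemma orbit_endo_in_centralizer:
  assumes G: "subgroup G (sym_group n)" and t: "t \<in> tuples n (2 * k)"
  shows "(orbit_endo n k G t :: 'f::field tensor_map) \<in> centralizer_algebra n k G"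
proof -
  note perm = subgroup_sym_group_permutes[OF G]
  \<comment> \<open>All endomorphisms form a subspace, being the centralizer of no permutations at all.\<close>
  have "endo.subspace (tensor_End n k :: 'f tensor_map set)"
    using subspace_centralizer_algebra[of n k "{}"] by (simp add: centralizer_algebra_def)
  then have "(orbit_endo n k G t :: 'f tensor_map) \<in> tensor_End n k"
    unfolding orbit_endo_def using tuple_orbit_subset[OF G t]
    by (auto intro!: endo.subspace_sum matrix_unit_in_tensor_End tuples_halves)
  then show ?thesis
    by (simp add: centralizer_iff_coeff_invariant[OF perm] matrix_coeff_orbit_endo[OF G t]
        map_permutes_in_tuples[OF perm] tuple_orbit_map[OF G])
qed

section \<open>The basis of the centralizer algebra\<close>

lemma tuple_orbit_inj_on_representatives:
  assumes G: "subgroup G (sym_group n)" and T: "orbit_representatives n m G T"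
  shows "inj_on (tuple_orbit n m G) T"
proof (rule inj_onI)
  fix s t assume st: "s \<in> T" "t \<in> T" "tuple_orbit n m G s = tuple_orbit n m G t"
  then have "s \<in> tuples n m" "t \<in> tuples n m"
    using T by (auto simp: orbit_representatives_def)
  then have "s \<in> tuple_orbit n m G t" "t \<in> tuple_orbit n m G t"
      "tuple_orbit n m G t \<in> tuple_orbits n m G"
    using st in_tuple_orbit_iff[OF G] by (auto simp: tuple_orbits_eq)
  with T st show "s = t" unfolding orbit_representatives_def by blast
qed

lemma representative_exists:
  assumes G: "subgroup G (sym_group n)" and T: "orbit_representatives n m G T"
    and q: "q \<in> tuples n m"
  obtains t where "t \<in> T" "tuple_orbit n m G t = tuple_orbit n m G q"
proof -
  have "tuple_orbit n m G q \<in> tuple_orbits n m G" using q by (simp add: tuple_orbits_eq)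
  with T obtain t where "t \<in> T" "t \<in> tuples n m" "t \<in> tuple_orbit n m G q"
    unfolding orbit_representatives_def by blast
  with that show ?thesis using in_tuple_orbit_iff[OF G _ q] by blast
qed

lemma card_representatives:
  assumes G: "subgroup G (sym_group n)" and T: "orbit_representatives n m G T"
  shows "card T = card (tuple_orbits n m G)"
proof (rule bij_betw_same_card[of "tuple_orbit n m G"])
  have "tuple_orbit n m G ` T = tuple_orbits n m G"
  proof
    show "tuple_orbit n m G ` T \<subseteq> tuple_orbits n m G"
      using T by (auto simp: tuple_orbits_eq orbit_representatives_def)
    show "tuple_orbits n m G \<subseteq> tuple_orbit n m G ` T"
      unfolding tuple_orbits_eq using representative_exists[OF G T] by (metis image_iff image_subsetI)
  qed
  then show "bij_betw (tuple_orbit n m G) T (tuple_orbits n m G)"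
    using tuple_orbit_inj_on_representatives[OF G T] by (simp add: bij_betw_def)
qed

text \<open>
  The coefficients at the representatives are the dual coordinates of the family: the
  coefficient of \<open>X_s\<close> at \<open>t\<close> is \<open>1\<close> if \<open>s = t\<close> and \<open>0\<close> otherwise. So no member lies in the span
  of the others, and the only candidate for an expansion of \<open>\<phi>\<close> uses the coefficients of \<open>\<phi>\<close> at
  the representatives; invariance makes it agree with \<open>\<phi>\<close> at every other tuple.
\<close>

lemma orbit_endo_basis:
  fixes V :: "'f::field tensor_map set"
  assumes G: "subgroup G (sym_group n)" and T: "orbit_representatives n (2 * k) G T"
  defines "V \<equiv> centralizer_algebra n k G"
  shows "is_basis_family (orbit_endo n k G) T V"
proof -
  let ?X = "orbit_endo n k G :: nat list \<Rightarrow> 'f tensor_map"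
  note perm = subgroup_sym_group_permutes[OF G]
  have Tsub: "T \<subseteq> tuples n (2 * k)" using T by (simp add: orbit_representatives_def)
  have finT: "finite T" by (rule finite_subset[OF Tsub finite_tuples])
  have dual: "matrix_coeff k (?X s) t = (if s = t then 1 else 0)"
    if "s \<in> T" "t \<in> T" for s t
  proof -
    have "s \<in> tuples n (2 * k)" "t \<in> tuples n (2 * k)" using that Tsub by auto
    then show ?thesis
      using inj_onD[OF tuple_orbit_inj_on_representatives[OF G T] _ that]
      by (auto simp: matrix_coeff_orbit_endo[OF G])
  qed
  have inj: "inj_on ?X T"
  proof (rule inj_onI)
    fix s t assume st: "s \<in> T" "t \<in> T" "?X s = ?X t"
    have "matrix_coeff k (?X s) t = 1" using dual[of t t] st by simp
    with dual[of s t] st show "s = t" by (simp split: if_splits)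
  qed
  have indep: "endo.independent (?X ` T)"
  proof
    assume "endo.dependent (?X ` T)"
    then obtain t where t: "t \<in> T" "?X t \<in> endo.span (?X ` T - {?X t})"
      by (auto simp: endo.dependent_def)
    have "endo.subspace {\<phi> :: 'f tensor_map. matrix_coeff k \<phi> t = 0}"
      by (intro endo.subspaceI)
        (simp_all add: matrix_coeff_0 matrix_coeff_add matrix_coeff_scale)
    moreover have "?X ` T - {?X t} \<subseteq> {\<phi>. matrix_coeff k \<phi> t = 0}"
      using t(1) by (auto simp: dual)
    ultimately have "endo.span (?X ` T - {?X t}) \<subseteq> {\<phi>. matrix_coeff k \<phi> t = 0}"
      by (intro endo.span_minimal)
    with t have "matrix_coeff k (?X t) t = 0" by blast
    with dual[OF t(1) t(1)] show False by simp
  qed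
  have subV: "endo.subspace V" unfolding V_def by (rule subspace_centralizer_algebra)
  have XV: "?X t \<in> V" if "t \<in> T" for t
    unfolding V_def using that Tsub by (blast intro: orbit_endo_in_centralizer[OF G])
  have span: "endo.span (?X ` T) = V"
  proof
    show "endo.span (?X ` T) \<subseteq> V"
      using XV by (intro endo.span_minimal subV) blast
    show "V \<subseteq> endo.span (?X ` T)"
    proof
      fix \<phi> assume \<phi>: "\<phi> \<in> V"
      define \<psi> where "\<psi> = (\<Sum>t \<in> T. end_scale (matrix_coeff k \<phi> t) (?X t))"
      have \<psi>: "\<psi> \<in> V"
        unfolding \<psi>_def by (intro endo.subspace_sum[OF subV] endo.subspace_scale[OF subV] XV)
      have "\<phi> = \<psi>"
      proof (rule tensor_End_eqI)
        show "\<phi> \<in> tensor_End n k" "\<psi> \<in> tensor_End n k"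
          using \<phi> \<psi> by (simp_all add: V_def centralizer_algebra_def)
        fix q assume q: "q \<in> tuples n (2 * k)"
        obtain t where t: "t \<in> T"
            and orb: "tuple_orbit n (2 * k) G t = tuple_orbit n (2 * k) G q"
          using representative_exists[OF G T q] .
        have tt: "t \<in> tuples n (2 * k)" using t Tsub by blast
        have "q \<in> tuple_orbit n (2 * k) G t"
          using in_tuple_orbit_iff[OF G q tt] orb by simp
        then obtain \<sigma> where "\<sigma> \<in> G" "q = map \<sigma> t" by (auto simp: tuple_orbit_eq[OF tt])
        then have const: "matrix_coeff k \<chi> q = matrix_coeff k \<chi> t" if "\<chi> \<in> V" for \<chi>
          using that tt by (simp add: V_def centralizer_iff_coeff_invariant[OF perm])
        have "matrix_coeff k \<psi> t = (\<Sum>s \<in> T. if s = t then matrix_coeff k \<phi> s else 0)"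
          unfolding \<psi>_def matrix_coeff_sum matrix_coeff_scale
          using t by (intro sum.cong) (auto simp: dual)
        also have "\<dots> = matrix_coeff k \<phi> t" using finT t by simp
        finally show "matrix_coeff k \<phi> q = matrix_coeff k \<psi> q"
          using const[OF \<phi>] const[OF \<psi>] by simp
      qed
      also have "\<psi> \<in> endo.span (?X ` T)"
        unfolding \<psi>_def by (intro endo.span_sum endo.span_scale endo.span_base) blast
      finally show "\<phi> \<in> endo.span (?X ` T)" .
    qed
  qed
  show ?thesis using inj indep span by (simp add: is_basis_family_def)
qed

theorem theorem5p4:
  fixes n k :: nat and G :: "(nat \<Rightarrow> nat) set"
  assumes "n \<ge> 1" and "k \<ge> 1" and "subgroup G (sym_group n)"
  shows "(\<forall>T. orbit_representatives n (2 * k) G T \<longrightarrow>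
            is_basis_family (orbit_endo n k G) T
              (centralizer_algebra n k G :: 'f::field_char_0 tensor_map set))
       \<and> endo.dim (centralizer_algebra n k G :: 'f tensor_map set)
           = card (tuple_orbits n (2 * k) G)"
proof (intro conjI allI impI)
  note G = assms(3)
  show "is_basis_family (orbit_endo n k G) T (centralizer_algebra n k G :: 'f tensor_map set)"
    if "orbit_representatives n (2 * k) G T" for T
    using orbit_endo_basis[OF G that] .
  obtain T where T: "orbit_representatives n (2 * k) G T"
    using orbit_representatives_exist[OF G] by blast
  have basis: "is_basis_family (orbit_endo n k G) T (centralizer_algebra n k G :: 'f tensor_map set)"
    by (rule orbit_endo_basis[OF G T])
  then have "endo.dim (centralizer_algebra n k G :: 'f tensor_map set)
      = card ((orbit_endo n k G :: nat list \<Rightarrow> 'f tensor_map) ` T)"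
    unfolding is_basis_family_def by (metis endo.dim_span_eq_card_independent)
  also have "\<dots> = card T"
    using basis by (simp add: is_basis_family_def card_image)
  also have "\<dots> = card (tuple_orbits n (2 * k) G)" by (rule card_representatives[OF G T])
  finally show "endo.dim (centralizer_algebra n k G :: 'f tensor_map set)
      = card (tuple_orbits n (2 * k) G)" .
qed

end
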